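(* Let $\{\mathcal L_\alpha\}_{\alpha\in\Omega}$ be a family of simple closure spaces, $\mathcal L_\alpha$ on $\Sigma_\alpha$, and let $\beta\in\Omega$. If $z$ is a central element of $\mathcal L_\beta$, then $\pi_\beta^{-1}(z)$ is a central element of $\overline{\bigotimes}_\alpha\mathcal L_\alpha$.
   Context: A simple closure space on a nonempty set $\Sigma$ is a set $\mathcal L\subseteq 2^\Sigma$, ordered by inclusion, closed under arbitrary intersections and containing $\Sigma$, $\emptyset$ and all singletons; it is a complete atomistic lattice. "Central element" has its standard lattice-theoretic meaning: an element $z$ of a lattice $\mathcal L$ with $0,1$ is central if there are lattices $M_1,M_2$ with $0,1$ and an isomorphism $\mathcal L\cong M_1\times M_2$ sending $z$ to $(1,0)$. Let $\mathbf\Sigma=\prod_\alpha\Sigma_\alpha$ with coordinate maps $\pi_\alpha$. For $p\in\mathbf\Sigma$ and $q\in\Sigma_\beta$, $p[q,\beta]$ is $p$ with its $\beta$-th entry replaced by $q$; for $R\subseteq\mathbf\Sigma$, $R_\beta[p]=\{q\in\Sigma_\beta:p[q,\beta]\in R\}$. Then $\overline{\bigotimes}_\alpha\mathcal L_\alpha:=\{R\subseteq\mathbf\Sigma: R_\beta[p]\in\mathcal L_\beta\text{ for all }p\in\mathbf\Sigma,\beta\in\Omega\}$, a simple closure space on $\mathbf\Sigma$. *)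

theory Defs
  imports "HOL-Algebra.Lattice" "HOL-Library.FuncSet"
begin

text \<open>\<open>C\<close> is taken nonempty because the empty intersection inside \<open>\<Sigma>\<close> is \<open>\<Sigma>\<close>, not \<open>UNIV\<close>.\<close>

definition simple_closure_space :: "'a set \<Rightarrow> 'a set set \<Rightarrow> bool" where
  "simple_closure_space \<Sigma> L \<longleftrightarrow>
     \<Sigma> \<noteq> {} \<and> L \<subseteq> Pow \<Sigma> \<and> \<Sigma> \<in> L \<and> {} \<in> L \<and> (\<forall>x\<in>\<Sigma>. {x} \<in> L) \<and>
     (\<forall>C. C \<subseteq> L \<and> C \<noteq> {} \<longrightarrow> \<Inter>C \<in> L)"

definition inclusion_order :: "'a set set \<Rightarrow> 'a set gorder" where
  "inclusion_order L = \<lparr>carrier = L, eq = (=), le = (\<subseteq>)\<rparr>"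

definition prod_order :: "'a gorder \<Rightarrow> 'b gorder \<Rightarrow> ('a \<times> 'b) gorder" where
  "prod_order M N =
     \<lparr>carrier = carrier M \<times> carrier N, eq = (=),
      le = (\<lambda>x y. fst x \<sqsubseteq>\<^bsub>M\<^esub> fst y \<and> snd x \<sqsubseteq>\<^bsub>N\<^esub> snd y)\<rparr>"

definition order_iso :: "'a gorder \<Rightarrow> 'b gorder \<Rightarrow> ('a \<Rightarrow> 'b) \<Rightarrow> bool" where
  "order_iso M N h \<longleftrightarrow> bij_betw h (carrier M) (carrier N) \<and> order_emb M N h"

text \<open>HOL cannot quantify over the element types of the two factors, so both are taken over the
  element type of the lattice itself. This is no restriction: see \<open>central_elementI\<close> below.\<close>

definition central_element :: "'a gorder \<Rightarrow> 'a \<Rightarrow> bool" where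
  "central_element L z \<longleftrightarrow>
     z \<in> carrier L \<and>
     (\<exists>(M\<^sub>1 :: 'a gorder) (M\<^sub>2 :: 'a gorder) h.
        bounded_lattice M\<^sub>1 \<and> bounded_lattice M\<^sub>2 \<and>
        order_iso L (prod_order M\<^sub>1 M\<^sub>2) h \<and> h z = (\<top>\<^bsub>M\<^sub>1\<^esub>, \<bottom>\<^bsub>M\<^sub>2\<^esub>))"

definition slice :: "('i \<Rightarrow> 'a set) \<Rightarrow> ('i \<Rightarrow> 'a) set \<Rightarrow> 'i \<Rightarrow> ('i \<Rightarrow> 'a) \<Rightarrow> 'a set" where
  "slice \<Sigma> R \<beta> p = {q \<in> \<Sigma> \<beta>. p(\<beta> := q) \<in> R}"

definition closure_tensor ::
    "'i set \<Rightarrow> ('i \<Rightarrow> 'a set) \<Rightarrow> ('i \<Rightarrow> 'a set set) \<Rightarrow> ('i \<Rightarrow> 'a) set set" where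
  "closure_tensor \<Omega> \<Sigma> L =
     {R. R \<subseteq> PiE \<Omega> \<Sigma> \<and> (\<forall>p \<in> PiE \<Omega> \<Sigma>. \<forall>\<beta>\<in>\<Omega>. slice \<Sigma> R \<beta> p \<in> L \<beta>)}"

definition cylinder :: "'i set \<Rightarrow> ('i \<Rightarrow> 'a set) \<Rightarrow> 'i \<Rightarrow> 'a set \<Rightarrow> ('i \<Rightarrow> 'a) set" where
  "cylinder \<Omega> \<Sigma> \<beta> z = {p \<in> PiE \<Omega> \<Sigma>. p \<beta> \<in> z}"

lemma weak_partial_order_prod_order:
  assumes "partial_order M" "partial_order N"
  shows "weak_partial_order (prod_order M N)"
proof -
  interpret M: partial_order M by fact
  interpret N: partial_order N by fact
  show ?thesis
    by unfold_locales
      (auto simp: prod_order_def dest: M.le_antisym N.le_antisym intro: M.le_trans N.le_trans)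
qed

lemma bounded_lattice_transport:
  fixes M :: "'b gorder" and f :: "'b \<Rightarrow> 'a"
  assumes M: "bounded_lattice M" and inj: "inj_on f (carrier M)"
  defines "g \<equiv> inv_into (carrier M) f"
  defines "(N :: 'a gorder) \<equiv> \<lparr>carrier = f ` carrier M, eq = (=), le = (\<lambda>x y. g x \<sqsubseteq>\<^bsub>M\<^esub> g y)\<rparr>"
  shows "bounded_lattice N" "\<top>\<^bsub>N\<^esub> = f \<top>\<^bsub>M\<^esub>" "\<bottom>\<^bsub>N\<^esub> = f \<bottom>\<^bsub>M\<^esub>"
proof -
  interpret M: bounded_lattice M by (fact M)
  have gf: "g (f x) = x" if "x \<in> carrier M" for x
    using that inj by (simp add: g_def)
  have lN: "le N (f x) (f y) \<longleftrightarrow> le M x y" if "x \<in> carrier M" "y \<in> carrier M" for x y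
    using that by (auto simp: N_def gf)
  have cN: "carrier N = f ` carrier M" and eN: "eq N = (=)" by (auto simp: N_def)
  have po: "partial_order N"
  proof unfold_locales
    show "(.=\<^bsub>N\<^esub>) = (=)" by (fact eN)
  qed (auto simp: cN eN lN intro: M.le_trans dest: M.le_antisym)
  interpret N: partial_order N by (fact po)
  have least_f: "least N (f x) (f ` A)" if "least M x A" "A \<subseteq> carrier M" for x A
    using that unfolding least_def cN by (auto simp: lN subset_iff)
  have greatest_f: "greatest N (f x) (f ` A)" if "greatest M x A" "A \<subseteq> carrier M" for x A
    using that unfolding greatest_def cN by (auto simp: lN subset_iff)
  have U: "Upper N (f ` A) = f ` Upper M A" if "A \<subseteq> carrier M" for A
  proof -
    have [simp]: "f ` A \<inter> f ` carrier M = f ` A" "A \<inter> carrier M = A" using that by auto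
    show ?thesis using that unfolding Upper_def cN
      by (force simp: lN subset_iff image_iff)
  qed
  have L: "Lower N (f ` A) = f ` Lower M A" if "A \<subseteq> carrier M" for A
  proof -
    have [simp]: "f ` A \<inter> f ` carrier M = f ` A" "A \<inter> carrier M = A" using that by auto
    show ?thesis using that unfolding Lower_def cN
      by (force simp: lN subset_iff image_iff)
  qed
  have sup: "\<exists>s. least N s (Upper N {x, y})" if xy: "x \<in> carrier N" "y \<in> carrier N" for x y
  proof -
    obtain a b where ab: "a \<in> carrier M" "b \<in> carrier M" "x = f a" "y = f b"
      using xy unfolding cN by auto
    obtain s where "least M s (Upper M {a, b})"
      using M.sup_of_two_exists ab by blast
    then show ?thesis
      using least_f[of s "Upper M {a, b}"] U[of "{a, b}"] ab by auto
  qed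
  have inf: "\<exists>s. greatest N s (Lower N {x, y})" if xy: "x \<in> carrier N" "y \<in> carrier N" for x y
  proof -
    obtain a b where ab: "a \<in> carrier M" "b \<in> carrier M" "x = f a" "y = f b"
      using xy unfolding cN by auto
    obtain s where "greatest M s (Lower M {a, b})"
      using M.inf_of_two_exists ab by blast
    then show ?thesis
      using greatest_f[of s "Lower M {a, b}"] L[of "{a, b}"] ab by auto
  qed
  have bot: "least N (f \<bottom>\<^bsub>M\<^esub>) (carrier N)"
    using least_f[OF M.bottom_least] cN by simp
  have top: "greatest N (f \<top>\<^bsub>M\<^esub>) (carrier N)"
    using greatest_f[OF M.top_greatest] cN by simp
  show bl: "bounded_lattice N"
    by unfold_locales (use sup inf bot top in auto)
  interpret N: bounded_lattice N by (fact bl)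
  show "\<top>\<^bsub>N\<^esub> = f \<top>\<^bsub>M\<^esub>"
    using top by (intro N.top_eq[symmetric]) (auto simp: greatest_def)
  show "\<bottom>\<^bsub>N\<^esub> = f \<bottom>\<^bsub>M\<^esub>"
    using bot by (intro N.bottom_eq[symmetric]) (auto simp: least_def)
qed

lemma central_elementI:
  fixes L :: "'a gorder" and M\<^sub>1 :: "'b gorder" and M\<^sub>2 :: "'c gorder"
  assumes z: "z \<in> carrier L"
    and M1: "bounded_lattice M\<^sub>1" and M2: "bounded_lattice M\<^sub>2"
    and iso: "order_iso L (prod_order M\<^sub>1 M\<^sub>2) h" and hz: "h z = (\<top>\<^bsub>M\<^sub>1\<^esub>, \<bottom>\<^bsub>M\<^sub>2\<^esub>)"
  shows "central_element L z"
proof -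
  interpret M1: bounded_lattice M\<^sub>1 by (fact M1)
  interpret M2: bounded_lattice M\<^sub>2 by (fact M2)
  define k where "k = inv_into (carrier L) h"
  have bij: "bij_betw h (carrier L) (carrier M\<^sub>1 \<times> carrier M\<^sub>2)"
    and emb: "\<And>x y. x \<in> carrier L \<Longrightarrow> y \<in> carrier L \<Longrightarrow>
      (fst (h x) \<sqsubseteq>\<^bsub>M\<^sub>1\<^esub> fst (h y) \<and> snd (h x) \<sqsubseteq>\<^bsub>M\<^sub>2\<^esub> snd (h y)) = (x \<sqsubseteq>\<^bsub>L\<^esub> y)"
    using iso by (auto simp: order_iso_def prod_order_def order_emb_def)
  have injk: "inj_on k (carrier M\<^sub>1 \<times> carrier M\<^sub>2)"
    using bij_betw_inv_into[OF bij] by (auto simp: k_def bij_betw_def)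
  define f\<^sub>1 where "f\<^sub>1 = (\<lambda>a. k (a, \<bottom>\<^bsub>M\<^sub>2\<^esub>))"
  define f\<^sub>2 where "f\<^sub>2 = (\<lambda>b. k (\<bottom>\<^bsub>M\<^sub>1\<^esub>, b))"
  have i1: "inj_on f\<^sub>1 (carrier M\<^sub>1)" and i2: "inj_on f\<^sub>2 (carrier M\<^sub>2)"
    using inj_onD[OF injk] by (fastforce simp: inj_on_def f\<^sub>1_def f\<^sub>2_def)+
  define N\<^sub>1 :: "'a gorder" where "N\<^sub>1 = \<lparr>carrier = f\<^sub>1 ` carrier M\<^sub>1, eq = (=),
    le = (\<lambda>x y. inv_into (carrier M\<^sub>1) f\<^sub>1 x \<sqsubseteq>\<^bsub>M\<^sub>1\<^esub> inv_into (carrier M\<^sub>1) f\<^sub>1 y)\<rparr>"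
  define N\<^sub>2 :: "'a gorder" where "N\<^sub>2 = \<lparr>carrier = f\<^sub>2 ` carrier M\<^sub>2, eq = (=),
    le = (\<lambda>x y. inv_into (carrier M\<^sub>2) f\<^sub>2 x \<sqsubseteq>\<^bsub>M\<^sub>2\<^esub> inv_into (carrier M\<^sub>2) f\<^sub>2 y)\<rparr>"
  note N1 = bounded_lattice_transport[OF M1 i1, folded N\<^sub>1_def]
  note N2 = bounded_lattice_transport[OF M2 i2, folded N\<^sub>2_def]
  define h' where "h' = map_prod f\<^sub>1 f\<^sub>2 \<circ> h"
  have "bij_betw (map_prod f\<^sub>1 f\<^sub>2) (carrier M\<^sub>1 \<times> carrier M\<^sub>2) (carrier N\<^sub>1 \<times> carrier N\<^sub>2)"
    using i1 i2 by (auto simp: bij_betw_def N\<^sub>1_def N\<^sub>2_def map_prod_inj_on)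
  with bij have b: "bij_betw h' (carrier L) (carrier N\<^sub>1 \<times> carrier N\<^sub>2)"
    unfolding h'_def by (rule bij_betw_trans)
  have hc: "fst (h x) \<in> carrier M\<^sub>1" "snd (h x) \<in> carrier M\<^sub>2" if "x \<in> carrier L" for x
    using bij_betwE[OF bij] that by (force simp: mem_Times_iff)+
  have "order_iso L (prod_order N\<^sub>1 N\<^sub>2) h'"
    unfolding order_iso_def order_emb_def
  proof (intro conjI ballI)
    show "weak_partial_order L"
      using iso by (simp add: order_iso_def order_emb_def)
    show "weak_partial_order (prod_order N\<^sub>1 N\<^sub>2)"
      using N1(1) N2(1)
      by (intro weak_partial_order_prod_order)
        (simp_all add: bounded_lattice_def lattice_def upper_semilattice_def)
    show "bij_betw h' (carrier L) (carrier (prod_order N\<^sub>1 N\<^sub>2))"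
      using b by (simp add: prod_order_def)
  next
    fix x y assume "x \<in> carrier L" "y \<in> carrier L"
    then show "h' x \<sqsubseteq>\<^bsub>prod_order N\<^sub>1 N\<^sub>2\<^esub> h' y \<longleftrightarrow> x \<sqsubseteq>\<^bsub>L\<^esub> y"
      using emb[of x y] hc i1 i2 by (simp add: prod_order_def h'_def N\<^sub>1_def N\<^sub>2_def)
  qed
  moreover have "h' z = (\<top>\<^bsub>N\<^sub>1\<^esub>, \<bottom>\<^bsub>N\<^sub>2\<^esub>)"
    using hz N1 N2 by (simp add: h'_def)
  ultimately show ?thesis
    using z N1(1) N2(1) unfolding central_element_def by blast
qed

end

theory Submission
  imports Defs
begin

text \<open>
  In a simple closure space, being central is a statement about subsets only. Let \<open>L\<close> be
  isomorphic to a product, with \<open>z\<close> sent to \<open>(\<top>, \<bottom>)\<close>. Points are atoms, and an atom of a product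
  lives in one of the two factors. Hence the element \<open>z'\<close> sent to \<open>(\<bottom>, \<top>)\<close> contains every point
  outside \<open>z\<close>, so it is the complement \<open>\<Sigma> - z\<close>, and the join of a closed part of \<open>z\<close> with a
  closed part of \<open>\<Sigma> - z\<close> acquires no new points: it is their union. Conversely, if \<open>z\<close> and
  \<open>\<Sigma> - z\<close> are closed and such unions are closed, then cutting along \<open>z\<close> is an isomorphism onto the
  product of the closed subsets of \<open>z\<close> and those of \<open>\<Sigma> - z\<close>. This is the criterion
  \<open>central_element_iff_clopen_split\<close>.

  The criterion passes through the tensor product, because membership there is tested on slices.
  A slice in direction \<open>\<beta>\<close> sees the cylinder over \<open>z\<close> as \<open>z\<close> itself, so that the criterion for \<open>z\<close>
  applies. A slice in any other direction keeps the \<open>\<beta>\<close>-th coordinate fixed, and so lies wholly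
  inside the cylinder or wholly outside it: there is nothing to glue.
\<close>

section \<open>Central elements of a simple closure space\<close>

text \<open>If \<open>L\<close> is a simple closure space on \<open>\<Sigma>\<close>, this says that a subset of \<open>\<Sigma>\<close> is closed exactly
  when its traces on \<open>z\<close> and on \<open>\<Sigma> - z\<close> are: the space is the disjoint sum of these two parts.\<close>

definition clopen_split :: "'a set \<Rightarrow> 'a set set \<Rightarrow> 'a set \<Rightarrow> bool" where
  "clopen_split \<Sigma> L z \<longleftrightarrow>
     z \<in> L \<and> \<Sigma> - z \<in> L \<and> (\<forall>a\<in>L. \<forall>b\<in>L. a \<subseteq> z \<longrightarrow> b \<subseteq> \<Sigma> - z \<longrightarrow> a \<union> b \<in> L)"

lemma inclusion_order_simps [simp]:
  "carrier (inclusion_order L) = L"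
  "eq (inclusion_order L) = (=)"
  "le (inclusion_order L) = (\<subseteq>)"
  by (simp_all add: inclusion_order_def)

lemma prod_order_simps [simp]:
  "carrier (prod_order M N) = carrier M \<times> carrier N"
  "le (prod_order M N) = (\<lambda>x y. le M (fst x) (fst y) \<and> le N (snd x) (snd y))"
  by (simp_all add: prod_order_def)

lemma simple_closure_space_Int:
  assumes "simple_closure_space \<Sigma> L" "a \<in> L" "b \<in> L"
  shows "a \<inter> b \<in> L"
proof -
  have "\<Inter>{a, b} \<in> L"
    using assms unfolding simple_closure_space_def by (metis empty_subsetI insert_not_empty insert_subset)
  then show ?thesis by simp
qed

lemma partial_order_inclusion_order: "partial_order (inclusion_order L)"
  by unfold_locales auto

text \<open>The join of two members is the intersection of all members above both; \<open>T\<close> is there to make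
  the family of these members nonempty.\<close>

lemma bounded_lattice_inclusion_order:
  assumes T: "T \<in> L" "L \<subseteq> Pow T" and empty: "{} \<in> L"
    and Inter: "\<And>C. C \<subseteq> L \<Longrightarrow> C \<noteq> {} \<Longrightarrow> \<Inter>C \<in> L"
  shows "bounded_lattice (inclusion_order L)"
    and "\<top>\<^bsub>inclusion_order L\<^esub> = T"
    and "\<bottom>\<^bsub>inclusion_order L\<^esub> = {}"
proof -
  interpret partial_order "inclusion_order L" by (rule partial_order_inclusion_order)
  have sup: "\<exists>s. least (inclusion_order L) s (Upper (inclusion_order L) {x, y})"
    if "x \<in> L" "y \<in> L" for x y
  proof
    let ?C = "{c \<in> L. x \<subseteq> c \<and> y \<subseteq> c}"
    have "T \<in> ?C" using T that by auto
    then have "\<Inter>?C \<in> L" by (intro Inter) auto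
    then show "least (inclusion_order L) (\<Inter>?C) (Upper (inclusion_order L) {x, y})"
      using that by (auto simp: least_def Upper_def)
  qed
  have inf: "\<exists>s. greatest (inclusion_order L) s (Lower (inclusion_order L) {x, y})"
    if "x \<in> L" "y \<in> L" for x y
  proof
    have "x \<inter> y \<in> L" using Inter[of "{x, y}"] that by simp
    then show "greatest (inclusion_order L) (x \<inter> y) (Lower (inclusion_order L) {x, y})"
      using that by (auto simp: greatest_def Lower_def)
  qed
  have bot: "least (inclusion_order L) {} (carrier (inclusion_order L))"
    and top: "greatest (inclusion_order L) T (carrier (inclusion_order L))"
    using T empty by (auto simp: least_def greatest_def)
  show bl: "bounded_lattice (inclusion_order L)"
    by unfold_locales (use sup inf bot top in auto)
  interpret bounded_lattice "inclusion_order L" by (fact bl)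
  show "\<top>\<^bsub>inclusion_order L\<^esub> = T"
    using T by (intro top_eq[symmetric]) auto
  show "\<bottom>\<^bsub>inclusion_order L\<^esub> = {}"
    using empty by (intro bottom_eq[symmetric]) auto
qed

text \<open>Points are atoms, so a point below \<open>(u, v)\<close> in a product lies below \<open>(u, \<bottom>)\<close> or below
  \<open>(\<bottom>, v)\<close>; this identifies the complement and shows that joins across the cut are unions.\<close>

lemma central_element_imp_clopen_split:
  assumes L: "simple_closure_space \<Sigma> L" and "central_element (inclusion_order L) z"
  shows "clopen_split \<Sigma> L z"
proof -
  obtain M N :: "'a set gorder" and h where
    z: "z \<in> L" and M: "bounded_lattice M" and N: "bounded_lattice N"
    and iso: "order_iso (inclusion_order L) (prod_order M N) h"
    and hz: "h z = (\<top>\<^bsub>M\<^esub>, \<bottom>\<^bsub>N\<^esub>)"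
    using assms(2) unfolding central_element_def by auto
  interpret M: bounded_lattice M by (fact M)
  interpret N: bounded_lattice N by (fact N)
  have bij: "bij_betw h L (carrier M \<times> carrier N)"
    using iso by (simp add: order_iso_def)
  have le_iff: "a \<subseteq> b \<longleftrightarrow> fst (h a) \<sqsubseteq>\<^bsub>M\<^esub> fst (h b) \<and> snd (h a) \<sqsubseteq>\<^bsub>N\<^esub> snd (h b)"
    if "a \<in> L" "b \<in> L" for a b
    using iso that by (simp add: order_iso_def order_emb_def)
  have carr: "fst (h a) \<in> carrier M" "snd (h a) \<in> carrier N" if "a \<in> L" for a
    using bij_betwE[OF bij] that by (force simp: mem_Times_iff)+
  have preimage: "\<exists>a\<in>L. h a = (u, v)" if "u \<in> carrier M" "v \<in> carrier N" for u v
  proof -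
    have "(u, v) \<in> h ` L" using bij that by (simp add: bij_betw_def)
    then show ?thesis by (auto simp: image_iff)
  qed
  have sub: "L \<subseteq> Pow \<Sigma>" and empty: "{} \<in> L" and single: "\<And>x. x \<in> \<Sigma> \<Longrightarrow> {x} \<in> L"
    using L by (auto simp: simple_closure_space_def)
  obtain z' where z': "z' \<in> L" "h z' = (\<bottom>\<^bsub>M\<^esub>, \<top>\<^bsub>N\<^esub>)"
    using preimage[of "\<bottom>\<^bsub>M\<^esub>" "\<top>\<^bsub>N\<^esub>"] by auto
  have below_z: "snd (h a) = \<bottom>\<^bsub>N\<^esub>" if "a \<in> L" "a \<subseteq> z" for a
    using le_iff[of a z] that z hz carr[of a] N.le_antisym N.bottom_lower by auto
  have below_z': "fst (h a) = \<bottom>\<^bsub>M\<^esub>" if "a \<in> L" "a \<subseteq> z'" for a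
    using le_iff[of a z'] that z' carr[of a] M.le_antisym M.bottom_lower by auto
  have cover: "x \<in> z \<or> x \<in> z'" if x: "x \<in> \<Sigma>" for x
  proof -
    obtain u v where uv: "h {x} = (u, v)" "u \<in> carrier M" "v \<in> carrier N"
      using carr[OF single[OF x]] by (cases "h {x}") auto
    obtain a b where a: "a \<in> L" "h a = (u, \<bottom>\<^bsub>N\<^esub>)" and b: "b \<in> L" "h b = (\<bottom>\<^bsub>M\<^esub>, v)"
      using preimage[of u "\<bottom>\<^bsub>N\<^esub>"] preimage[of "\<bottom>\<^bsub>M\<^esub>" v] uv by auto
    \<comment> \<open>As \<open>a\<close> and \<open>b\<close> lie below the atom \<open>{x}\<close>, each is \<open>{}\<close> or \<open>{x}\<close>; whichever is \<open>{x}\<close> decides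
      on which side of the cut \<open>x\<close> falls.\<close>
    have "a \<subseteq> {x}" "b \<subseteq> {x}" "a \<subseteq> z" "b \<subseteq> z'"
      using a b uv z z' hz single[OF x]
      by (simp_all add: le_iff M.le_refl N.le_refl M.bottom_lower N.bottom_lower
          M.top_higher N.top_higher)
    moreover have "a \<noteq> {} \<or> b \<noteq> {}"
    proof (rule ccontr)
      assume "\<not> (a \<noteq> {} \<or> b \<noteq> {})"
      \<comment> \<open>If both were empty, then \<open>(u, \<bottom>) = (\<bottom>, v) = h {}\<close>, so \<open>u\<close> and \<open>v\<close> would be bottom.\<close>
      then have "h {x} = h {}" using a b uv by auto
      then have "{x} = {}"
        using bij single[OF x] empty unfolding bij_betw_def inj_on_def by blast
      then show False by simp
    qed
    ultimately show ?thesis by blast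
  qed
  have disjoint: "z \<inter> z' = {}"
  proof (rule ccontr)
    assume "z \<inter> z' \<noteq> {}"
    then obtain x where x: "x \<in> z" "x \<in> z'" by auto
    then have xL: "{x} \<in> L" using sub z single by auto
    have "fst (h {x}) = \<bottom>\<^bsub>M\<^esub>" "snd (h {x}) = \<bottom>\<^bsub>N\<^esub>"
      using below_z[OF xL] below_z'[OF xL] x by auto
    then have "{x} \<subseteq> {}"
      using le_iff[OF xL empty] carr[OF empty] M.bottom_lower N.bottom_lower by simp
    then show False by simp
  qed
  have compl: "z' = \<Sigma> - z"
    using cover disjoint sub z' by auto
  have "a \<union> b \<in> L" if a: "a \<in> L" "a \<subseteq> z" and b: "b \<in> L" "b \<subseteq> z'" for a b
  proof -
    \<comment> \<open>This \<open>c\<close> is the join of \<open>a\<close> and \<open>b\<close>, computed componentwise in the product.\<close>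
    obtain c where c: "c \<in> L" "h c = (fst (h a), snd (h b))"
      using preimage[of "fst (h a)" "snd (h b)"] carr a b by auto
    have "a \<subseteq> c" "b \<subseteq> c"
      using a b c carr below_z[OF a] below_z'[OF b]
      by (simp_all add: le_iff M.le_refl N.le_refl M.bottom_lower N.bottom_lower)
    moreover have "x \<in> a \<union> b" if x: "x \<in> c" for x
    proof -
      have xS: "x \<in> \<Sigma>" using x c sub by auto
      note xL = single[OF xS]
      have hx: "fst (h {x}) \<sqsubseteq>\<^bsub>M\<^esub> fst (h a)" "snd (h {x}) \<sqsubseteq>\<^bsub>N\<^esub> snd (h b)"
        using le_iff[OF xL c(1)] c x by auto
      from cover[OF xS] show ?thesis
      proof
        assume "x \<in> z"
        then have "{x} \<subseteq> a"
          using le_iff[OF xL a(1)] hx below_z[OF xL] carr[OF a(1)] N.bottom_lower by simp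
        then show ?thesis by simp
      next
        assume "x \<in> z'"
        then have "{x} \<subseteq> b"
          using le_iff[OF xL b(1)] hx below_z'[OF xL] carr[OF b(1)] M.bottom_lower by simp
        then show ?thesis by simp
      qed
    qed
    ultimately have "a \<union> b = c" by blast
    with c show ?thesis by simp
  qed
  then show ?thesis
    using z z' compl by (auto simp: clopen_split_def)
qed

text \<open>Closure under intersection makes both parts of a closed set closed when it is cut along \<open>z\<close>, and
  the gluing condition makes every pair of closed parts arise in this way. The two factors are
  the ideals below \<open>z\<close> and below \<open>\<Sigma> - z\<close>.\<close>

lemma clopen_split_imp_central_element:
  assumes L: "simple_closure_space \<Sigma> L" and split: "clopen_split \<Sigma> L z"
  shows "central_element (inclusion_order L) z"
proof -
  let ?I = "\<lambda>w. {a \<in> L. a \<subseteq> w}"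
  let ?h = "\<lambda>a. (a \<inter> z, a - z)"
  have sub: "L \<subseteq> Pow \<Sigma>" and empty: "{} \<in> L"
    and Inter: "\<And>C. C \<subseteq> L \<Longrightarrow> C \<noteq> {} \<Longrightarrow> \<Inter>C \<in> L"
    using L by (auto simp: simple_closure_space_def)
  have z: "z \<in> L" and z': "\<Sigma> - z \<in> L"
    and un: "\<And>a b. a \<in> L \<Longrightarrow> b \<in> L \<Longrightarrow> a \<subseteq> z \<Longrightarrow> b \<subseteq> \<Sigma> - z \<Longrightarrow> a \<union> b \<in> L"
    using split by (auto simp: clopen_split_def)
  have ideal: "bounded_lattice (inclusion_order (?I w))"
    "\<top>\<^bsub>inclusion_order (?I w)\<^esub> = w" "\<bottom>\<^bsub>inclusion_order (?I w)\<^esub> = {}"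
    if "w \<in> L" for w
  proof -
    have "\<Inter>C \<in> ?I w" if C: "C \<subseteq> ?I w" "C \<noteq> {}" for C
    proof -
      have "\<Inter>C \<in> L" using C by (intro Inter) auto
      then show ?thesis using C by auto
    qed
    note * = bounded_lattice_inclusion_order[where T = w and L = "?I w", OF _ _ _ this]
    show "bounded_lattice (inclusion_order (?I w))"
      "\<top>\<^bsub>inclusion_order (?I w)\<^esub> = w" "\<bottom>\<^bsub>inclusion_order (?I w)\<^esub> = {}"
      by (rule *; use \<open>w \<in> L\<close> empty in auto)+
  qed
  have cut: "a \<inter> z \<in> L" "a - z \<in> L" if "a \<in> L" for a
  proof -
    show "a \<inter> z \<in> L" using simple_closure_space_Int[OF L that z] .
    have "a \<inter> (\<Sigma> - z) = a - z" using that sub by auto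
    then show "a - z \<in> L" using simple_closure_space_Int[OF L that z'] by simp
  qed
  have bij: "bij_betw ?h L (?I z \<times> ?I (\<Sigma> - z))"
  proof (rule bij_betw_byWitness[where f' = "\<lambda>(a, b). a \<union> b"])
    show "?h ` L \<subseteq> ?I z \<times> ?I (\<Sigma> - z)"
      using cut sub by auto
    show "(\<lambda>(a, b). a \<union> b) ` (?I z \<times> ?I (\<Sigma> - z)) \<subseteq> L"
      using un by auto
  qed auto
  have "order_iso (inclusion_order L)
      (prod_order (inclusion_order (?I z)) (inclusion_order (?I (\<Sigma> - z)))) ?h"
    unfolding order_iso_def order_emb_def
  proof (intro conjI ballI)
    show "weak_partial_order (inclusion_order L)"
      using partial_order_inclusion_order[of L] by (simp add: partial_order_def)
    show "weak_partial_order
        (prod_order (inclusion_order (?I z)) (inclusion_order (?I (\<Sigma> - z))))"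
      by (intro weak_partial_order_prod_order partial_order_inclusion_order)
  qed (use bij in auto)
  moreover have "?h z = (\<top>\<^bsub>inclusion_order (?I z)\<^esub>, \<bottom>\<^bsub>inclusion_order (?I (\<Sigma> - z))\<^esub>)"
    using ideal(2)[OF z] ideal(3)[OF z'] by simp
  ultimately show ?thesis
    using central_elementI[of z "inclusion_order L", OF _ ideal(1)[OF z] ideal(1)[OF z']] z
    by simp
qed

lemma central_element_iff_clopen_split:
  assumes "simple_closure_space \<Sigma> L"
  shows "central_element (inclusion_order L) z \<longleftrightarrow> clopen_split \<Sigma> L z"
  using central_element_imp_clopen_split[OF assms] clopen_split_imp_central_element[OF assms]
  by blast

section \<open>Cylinders in the tensor product\<close>

lemma PiE_fun_upd:
  assumes "p \<in> PiE \<Omega> \<Sigma>" "\<alpha> \<in> \<Omega>" "q \<in> \<Sigma> \<alpha>"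
  shows "p(\<alpha> := q) \<in> PiE \<Omega> \<Sigma>"
  using assms by (auto simp: PiE_def extensional_def)

lemma slice_Un: "slice \<Sigma> (A \<union> B) \<alpha> p = slice \<Sigma> A \<alpha> p \<union> slice \<Sigma> B \<alpha> p"
  by (auto simp: slice_def)

lemma slice_cylinder_same:
  assumes "p \<in> PiE \<Omega> \<Sigma>" "\<beta> \<in> \<Omega>"
  shows "slice \<Sigma> (cylinder \<Omega> \<Sigma> \<beta> w) \<beta> p = \<Sigma> \<beta> \<inter> w"
  using assms by (auto simp: slice_def cylinder_def PiE_fun_upd)

lemma slice_cylinder_other:
  assumes "p \<in> PiE \<Omega> \<Sigma>" "\<alpha> \<in> \<Omega>" "\<alpha> \<noteq> \<beta>"
  shows "slice \<Sigma> (cylinder \<Omega> \<Sigma> \<beta> w) \<alpha> p = (if p \<beta> \<in> w then \<Sigma> \<alpha> else {})"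
  using assms by (auto simp: slice_def cylinder_def PiE_fun_upd)

text \<open>Slices commute with intersections, and a slice of a singleton has at most one element, so
  every closure condition is inherited from the factors.\<close>

lemma simple_closure_space_closure_tensor:
  assumes L: "\<And>\<alpha>. \<alpha> \<in> \<Omega> \<Longrightarrow> simple_closure_space (\<Sigma> \<alpha>) (L \<alpha>)"
  shows "simple_closure_space (PiE \<Omega> \<Sigma>) (closure_tensor \<Omega> \<Sigma> L)"
  unfolding simple_closure_space_def
proof (intro conjI ballI allI impI)
  note scs = L[unfolded simple_closure_space_def]
  show "PiE \<Omega> \<Sigma> \<noteq> {}"
    using scs by (auto simp: PiE_eq_empty_iff)
  show "closure_tensor \<Omega> \<Sigma> L \<subseteq> Pow (PiE \<Omega> \<Sigma>)"
    by (auto simp: closure_tensor_def)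
  have "slice \<Sigma> (PiE \<Omega> \<Sigma>) \<alpha> p = \<Sigma> \<alpha>" if "p \<in> PiE \<Omega> \<Sigma>" "\<alpha> \<in> \<Omega>" for \<alpha> p
    using that by (auto simp: slice_def PiE_fun_upd)
  then show "PiE \<Omega> \<Sigma> \<in> closure_tensor \<Omega> \<Sigma> L"
    using scs by (simp add: closure_tensor_def)
  show "{} \<in> closure_tensor \<Omega> \<Sigma> L"
    using scs by (simp add: closure_tensor_def slice_def)
next
  fix r assume r: "r \<in> PiE \<Omega> \<Sigma>"
  have "slice \<Sigma> {r} \<alpha> p \<in> L \<alpha>" if "p \<in> PiE \<Omega> \<Sigma>" "\<alpha> \<in> \<Omega>" for p \<alpha>
  proof -
    have "slice \<Sigma> {r} \<alpha> p \<subseteq> {r \<alpha>}"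
      by (auto simp: slice_def)
    moreover have "{} \<in> L \<alpha>" "{r \<alpha>} \<in> L \<alpha>"
      using L[OF that(2)] r that(2) by (auto simp: simple_closure_space_def)
    ultimately show ?thesis by (metis subset_singletonD)
  qed
  then show "{r} \<in> closure_tensor \<Omega> \<Sigma> L"
    using r by (simp add: closure_tensor_def)
next
  fix C assume C: "C \<subseteq> closure_tensor \<Omega> \<Sigma> L \<and> C \<noteq> {}"
  have "slice \<Sigma> (\<Inter>C) \<alpha> p \<in> L \<alpha>" if "p \<in> PiE \<Omega> \<Sigma>" "\<alpha> \<in> \<Omega>" for p \<alpha>
  proof -
    let ?D = "(\<lambda>R. slice \<Sigma> R \<alpha> p) ` C"
    have "?D \<subseteq> L \<alpha>" "?D \<noteq> {}"
      using C that by (auto simp: closure_tensor_def)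
    then have "\<Inter>?D \<in> L \<alpha>"
      using L[OF that(2)] unfolding simple_closure_space_def by blast
    moreover have "\<Inter>?D = slice \<Sigma> (\<Inter>C) \<alpha> p"
      using C by (auto simp: slice_def)
    ultimately show ?thesis by simp
  qed
  then show "\<Inter>C \<in> closure_tensor \<Omega> \<Sigma> L"
    using C by (fastforce simp: closure_tensor_def)
qed

lemma cylinder_in_closure_tensor:
  assumes L: "\<And>\<alpha>. \<alpha> \<in> \<Omega> \<Longrightarrow> simple_closure_space (\<Sigma> \<alpha>) (L \<alpha>)"
    and \<beta>: "\<beta> \<in> \<Omega>" and w: "w \<in> L \<beta>"
  shows "cylinder \<Omega> \<Sigma> \<beta> w \<in> closure_tensor \<Omega> \<Sigma> L"
proof -
  have "w \<subseteq> \<Sigma> \<beta>"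
    using L[OF \<beta>] w by (auto simp: simple_closure_space_def)
  then have "\<Sigma> \<beta> \<inter> w = w" by auto
  then have "slice \<Sigma> (cylinder \<Omega> \<Sigma> \<beta> w) \<alpha> p \<in> L \<alpha>" if "p \<in> PiE \<Omega> \<Sigma>" "\<alpha> \<in> \<Omega>" for p \<alpha>
    using that L[OF that(2)] w \<beta>
    by (cases "\<alpha> = \<beta>")
      (simp_all add: slice_cylinder_same slice_cylinder_other simple_closure_space_def)
  then show ?thesis
    by (auto simp: closure_tensor_def cylinder_def)
qed

lemma slice_mono: "A \<subseteq> B \<Longrightarrow> slice \<Sigma> A \<alpha> p \<subseteq> slice \<Sigma> B \<alpha> p"
  by (auto simp: slice_def)

text \<open>Gluing is checked slice by slice. Only a line in direction \<open>\<beta>\<close> can meet both cylinders; in every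
  other direction one of the two slices is empty.\<close>

lemma clopen_split_cylinder:
  assumes L: "\<And>\<alpha>. \<alpha> \<in> \<Omega> \<Longrightarrow> simple_closure_space (\<Sigma> \<alpha>) (L \<alpha>)"
    and \<beta>: "\<beta> \<in> \<Omega>" and split: "clopen_split (\<Sigma> \<beta>) (L \<beta>) z"
  shows "clopen_split (PiE \<Omega> \<Sigma>) (closure_tensor \<Omega> \<Sigma> L) (cylinder \<Omega> \<Sigma> \<beta> z)"
proof -
  let ?Z = "cylinder \<Omega> \<Sigma> \<beta> z" and ?Z' = "cylinder \<Omega> \<Sigma> \<beta> (\<Sigma> \<beta> - z)"
  have z: "z \<in> L \<beta>" and z': "\<Sigma> \<beta> - z \<in> L \<beta>"
    and un: "\<And>a b. a \<in> L \<beta> \<Longrightarrow> b \<in> L \<beta> \<Longrightarrow> a \<subseteq> z \<Longrightarrow> b \<subseteq> \<Sigma> \<beta> - z \<Longrightarrow> a \<union> b \<in> L \<beta>"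
    using split by (auto simp: clopen_split_def)
  have compl: "PiE \<Omega> \<Sigma> - ?Z = ?Z'"
    using \<beta> by (auto simp: cylinder_def)
  have glue: "A \<union> B \<in> closure_tensor \<Omega> \<Sigma> L"
    if A: "A \<in> closure_tensor \<Omega> \<Sigma> L" "A \<subseteq> ?Z" and B: "B \<in> closure_tensor \<Omega> \<Sigma> L" "B \<subseteq> ?Z'"
    for A B
  proof -
    have "slice \<Sigma> A \<alpha> p \<union> slice \<Sigma> B \<alpha> p \<in> L \<alpha>" if p: "p \<in> PiE \<Omega> \<Sigma>" and \<alpha>: "\<alpha> \<in> \<Omega>" for p \<alpha>
    proof -
      have closed: "slice \<Sigma> A \<alpha> p \<in> L \<alpha>" "slice \<Sigma> B \<alpha> p \<in> L \<alpha>"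
        using A(1) B(1) p \<alpha> by (auto simp: closure_tensor_def)
      have bounds: "slice \<Sigma> A \<alpha> p \<subseteq> slice \<Sigma> ?Z \<alpha> p" "slice \<Sigma> B \<alpha> p \<subseteq> slice \<Sigma> ?Z' \<alpha> p"
        using A(2) B(2) by (simp_all add: slice_mono)
      show ?thesis
      proof (cases "\<alpha> = \<beta>")
        case True
        then show ?thesis
          using un closed bounds p \<beta> by (simp add: slice_cylinder_same)
      next
        case False
        then have "slice \<Sigma> A \<alpha> p = {} \<or> slice \<Sigma> B \<alpha> p = {}"
          using bounds p \<alpha> by (auto simp: slice_cylinder_other split: if_splits)
        then show ?thesis using closed by auto
      qed
    qed
    then show ?thesis
      using A(1) B(1) by (simp add: closure_tensor_def slice_Un)
  qed
  show ?thesis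
    unfolding clopen_split_def compl
    using glue cylinder_in_closure_tensor[where \<Sigma> = \<Sigma> and L = L, OF L \<beta>] z z'
    by simp
qed

theorem theorem5p4:
  fixes \<Omega> :: "'i set" and \<Sigma> :: "'i \<Rightarrow> 'a set" and L :: "'i \<Rightarrow> 'a set set"
    and \<beta> :: 'i and z :: "'a set"
  assumes "\<And>\<alpha>. \<alpha> \<in> \<Omega> \<Longrightarrow> simple_closure_space (\<Sigma> \<alpha>) (L \<alpha>)"
    and "\<beta> \<in> \<Omega>"
    and "central_element (inclusion_order (L \<beta>)) z"
  shows "central_element (inclusion_order (closure_tensor \<Omega> \<Sigma> L)) (cylinder \<Omega> \<Sigma> \<beta> z)"
proof -
  have "clopen_split (\<Sigma> \<beta>) (L \<beta>) z"
    using central_element_iff_clopen_split assms by blast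
  then have "clopen_split (PiE \<Omega> \<Sigma>) (closure_tensor \<Omega> \<Sigma> L) (cylinder \<Omega> \<Sigma> \<beta> z)"
    using clopen_split_cylinder[where \<Sigma> = \<Sigma> and L = L, OF assms(1,2)] by blast
  then show ?thesis
    using central_element_iff_clopen_split
      simple_closure_space_closure_tensor[where \<Sigma> = \<Sigma> and L = L, OF assms(1)] by blast
qed

end
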